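(* Let $F:S^2\to\mathbb{R}$ be a continuous even map (i.e. $F(x)=F(-x)$ for all $x\in S^2$), and let $\{\pm v_i\mid 1\le i\le 4\}$ be the vertex set of a square based box inscribed to $S^2$. Then there exists $A\in SO(3)$ such that $F(\pm Av_1)=F(\pm Av_2)=F(\pm Av_3)=F(\pm Av_4)$.
   Context: $S^2$ is the unit sphere of $\mathbb{R}^3$ centred at the origin. A box is a (non-degenerate) rectangular parallelepiped; it is square based if it has a pair of opposite faces that are squares. It is inscribed to $S^2$ if all eight vertices lie on $S^2$; the vertices then form four antipodal pairs $\pm v_1,\dots,\pm v_4$. Since $F$ is even, $F(\pm Av_i)$ denotes the common value $F(Av_i)=F(-Av_i)$. *)

theory Defs
  imports "HOL-Analysis.Analysis"
begin

text \<open>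
  A (non-degenerate) box in three-space is given by a corner \<open>p\<close> and the three
  edge vectors \<open>a\<close>, \<open>b\<close>, \<open>c\<close> emanating from it.
\<close>

definition box_edges :: "real^3 \<Rightarrow> real^3 \<Rightarrow> real^3 \<Rightarrow> bool" where
  "box_edges a b c \<longleftrightarrow>
     a \<noteq> 0 \<and> b \<noteq> 0 \<and> c \<noteq> 0 \<and> orthogonal a b \<and> orthogonal b c \<and> orthogonal a c"

definition box_vertices :: "real^3 \<Rightarrow> real^3 \<Rightarrow> real^3 \<Rightarrow> real^3 \<Rightarrow> (real^3) set" where
  "box_vertices p a b c =
     {p, p + a, p + b, p + c, p + a + b, p + b + c, p + a + c, p + a + b + c}"

text \<open>
  Two opposite faces of a box are translates of each other, and each face is the rectangle
  spanned by two of the three edge vectors.  Hence the three disjuncts below correspond to the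
  three pairs of opposite faces.
\<close>

definition square_based :: "real^3 \<Rightarrow> real^3 \<Rightarrow> real^3 \<Rightarrow> bool" where
  "square_based a b c \<longleftrightarrow> norm a = norm b \<or> norm b = norm c \<or> norm a = norm c"

definition square_based_box_vertex_set :: "(real^3) set \<Rightarrow> bool" where
  "square_based_box_vertex_set V \<longleftrightarrow>
     (\<exists>p a b c. box_edges a b c \<and> square_based a b c \<and> V = box_vertices p a b c)"

end

theory Submission
  imports Defs
begin

text \<open>
  Write the vertices of the box, up to sign, as the four points \<open>g k \<plusminus> s i\<close>, \<open>g k \<plusminus> s j\<close> for an orthonormal
  frame \<open>(i, j, k)\<close>; they are the corners of the upper square face. The aim is a frame for which \<open>F\<close>
  has the same value at the four corners. With \<open>f\<^sub>0, f\<^sub>1, f\<^sub>2, f\<^sub>3\<close> for the values in cyclic order, put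
  \<open>w = f\<^sub>0 - f\<^sub>1 + f\<^sub>2 - f\<^sub>3\<close> and \<open>u = (f\<^sub>0 - f\<^sub>2) + \<i> (f\<^sub>1 - f\<^sub>3)\<close>. One looks for a common zero of \<open>w\<close> and \<open>u\<close>,
  that is, for a zero of a map from \<open>SO(3)\<close> to \<open>\<real>\<^sup>3\<close> which is equivariant for the dihedral group of
  symmetries of the box. A quarter turn acts on the target by \<open>(w, u) \<mapsto> (- w, - \<i> u)\<close>, and since \<open>F\<close>
  is even the half turn about the axis of \<open>j\<close> acts by \<open>(w, u) \<mapsto> (w, cnj u)\<close>.

  The obstruction to a nowhere vanishing map of this kind is found without homology, by lifting
  through the Hopf map \<open>S\<^sup>3 \<rightarrow> S\<^sup>2\<close>. Frames whose third vector lies in a closed hemisphere are parametrized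
  by a disc times the real line of angles, a contractible set, over which a map to \<open>S\<^sup>2\<close> has a lift to unit spinors
  (\<open>hopf_lift_convex\<close>), and this lift can be made equivariant for the quarter turn
  (\<open>equivariant_hopf_lift\<close>). Both symmetries of the target reverse orientation, so they act on spinors by antilinear
  maps, and the quarter turn acts there with fourth power \<open>- 1\<close>. The half turn, which glues
  the boundary of the hemisphere to itself, respects the lift only up to a phase. In terms of a
  logarithm of this phase the relations of the group become contradictory
  (\<open>twisted_map_has_zero\<close>).

  What remains is explicit geometry: formulas for the frames and their behaviour at the equator
  (\<open>frame_antipode\<close>), and the normal form of an inscribed square based box (\<open>inscribed_box_frame\<close>).
\<close>

section \<open>Spinors and the Hopf map\<close>

text \<open>
  The Hopf map from \<open>\<complex>\<^sup>2\<close> to \<open>\<real> \<times> \<complex> = \<real>\<^sup>3\<close>. On unit vectors it is the circle bundle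
  \<open>S\<^sup>3 \<rightarrow> S\<^sup>2\<close>, whose fibres are the orbits of multiplication by phases (see \<open>phase_unique\<close>).
\<close>

definition hopf :: "complex \<times> complex \<Rightarrow> real \<times> complex" where
  "hopf s = ((cmod (fst s))\<^sup>2 - (cmod (snd s))\<^sup>2, 2 * fst s * cnj (snd s))"

text \<open>
  For a unit vector \<open>v\<close> this is twice the orthogonal projection of \<open>s\<close> to the complex line in
  \<open>\<complex>\<^sup>2\<close> that the Hopf map sends to the ray of \<open>v\<close>.
\<close>

definition transport :: "real \<times> complex \<Rightarrow> complex \<times> complex \<Rightarrow> complex \<times> complex" where
  "transport v s =
     (of_real (1 + fst v) * fst s + snd v * snd s,
      cnj (snd v) * fst s + of_real (1 - fst v) * snd s)"

text \<open>
  The Hermitian product; on two unit spinors in the same fibre it is the phase by which they differ.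
\<close>

definition phase :: "complex \<times> complex \<Rightarrow> complex \<times> complex \<Rightarrow> complex" where
  "phase s t = fst t * cnj (fst s) + snd t * cnj (snd s)"

definition cscale :: "complex \<Rightarrow> complex \<times> complex \<Rightarrow> complex \<times> complex" where
  "cscale c s = (c * fst s, c * snd s)"

lemma norm_pair_sq: "(norm s)\<^sup>2 = (norm (fst s))\<^sup>2 + (norm (snd s))\<^sup>2"
  by (cases s) (simp add: norm_Pair)

lemma norm_hopf: "norm (hopf s) = (norm s)\<^sup>2"
proof (rule power2_eq_imp_eq)
  show "(norm (hopf s))\<^sup>2 = ((norm s)\<^sup>2)\<^sup>2"
    unfolding norm_pair_sq hopf_def
    by (simp add: norm_mult power_mult_distrib) (simp add: power2_eq_square algebra_simps)
qed auto

lemma hopf_scaleR: "hopf (c *\<^sub>R s) = c\<^sup>2 *\<^sub>R hopf s"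
  by (simp add: hopf_def power_mult_distrib complex_eq_iff power2_eq_square algebra_simps)

lemma hopf_cscale: "cmod c = 1 \<Longrightarrow> hopf (cscale c s) = hopf s"
proof -
  assume c: "cmod c = 1"
  have "c * cnj c = 1" using c by (simp add: complex_norm_square[symmetric])
  then have "2 * (c * fst s) * cnj (c * snd s) = 2 * fst s * cnj (snd s)"
    by (metis (no_types, opaque_lifting) complex_cnj_mult mult.assoc mult.left_commute mult_1)
  then show ?thesis using c by (simp add: hopf_def cscale_def norm_mult)
qed

lemma hopf_sgn:
  assumes "hopf s = y *\<^sub>R v" "y > 0" "norm v = 1"
  shows "hopf (sgn s) = v" "norm (sgn s) = 1"
proof -
  have n: "(norm s)\<^sup>2 = y" using norm_hopf[of s] assms by simp
  then have "s \<noteq> 0" using assms by auto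
  then show "norm (sgn s) = 1" by (simp add: norm_sgn)
  show "hopf (sgn s) = v"
    using assms n by (simp add: sgn_div_norm hopf_scaleR power_inverse)
qed

lemma hopf_transport:
  assumes v: "norm v = 1"
  shows "hopf (transport v s) = (2 * ((norm s)\<^sup>2 + v \<bullet> hopf s)) *\<^sub>R v"
proof -
  obtain w u a b where [simp]: "v = (w, u)" "s = (a, b)" by (cases v, cases s) auto
  obtain p q where u: "u = Complex p q" by (cases u)
  obtain a1 a2 where a: "a = Complex a1 a2" by (cases a)
  obtain b1 b2 where b: "b = Complex b1 b2" by (cases b)
  have "w\<^sup>2 + (p\<^sup>2 + q\<^sup>2) = 1"
    using v by (simp add: norm_Pair u cmod_power2)
  then have q: "q\<^sup>2 = 1 - w\<^sup>2 - p\<^sup>2" by simp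
  show ?thesis
    apply (simp add: hopf_def transport_def norm_Pair u a b complex_eq_iff cmod_power2 inner_complex_def)
    apply (intro conjI)
    using q unfolding power2_eq_square by algebra+
qed

text \<open>
  The projection of a unit spinor over \<open>w\<close> to the line over \<open>v\<close> vanishes only for \<open>v = - w\<close>. Hence it
  moves a lift to every point at distance less than 2, by a formula that is continuous in both
  arguments.
\<close>

lemma hopf_sgn_transport:
  assumes v: "norm v = 1" and s: "norm s = 1" and d: "dist v (hopf s) < 2"
  shows "hopf (sgn (transport v s)) = v" "norm (sgn (transport v s)) = 1" "transport v s \<noteq> 0"
proof -
  have h: "norm (hopf s) = 1" using s norm_hopf by simp
  have "(norm (v - hopf s))\<^sup>2 < 2\<^sup>2"
    using d by (intro power_strict_mono) (auto simp: dist_norm)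
  moreover have "(norm (v - hopf s))\<^sup>2 = 2 - 2 * (v \<bullet> hopf s)"
    using v h by (simp add: power2_norm_eq_inner inner_diff inner_commute norm_eq_1)
  ultimately have "2 * ((norm s)\<^sup>2 + v \<bullet> hopf s) > 0" using s by simp
  from hopf_sgn[OF hopf_transport[OF v] this v]
  show "hopf (sgn (transport v s)) = v" "norm (sgn (transport v s)) = 1" by auto
  then show "transport v s \<noteq> 0" by auto
qed

text \<open>
  Each unit vector is non-antipodal to one of the two poles, so a spinor over that pole can be
  transported to it.
\<close>

lemma hopf_surj_unit:
  assumes v: "norm v = 1"
  obtains s where "norm s = 1" "hopf s = v"
proof -
  define s :: "complex \<times> complex" where "s = (if v = (-1, 0) then (0, 1) else (1, 0))"
  have s: "s = (1, 0) \<or> s = (0, 1)" by (simp add: s_def)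
  have ne: "v \<noteq> - hopf s" by (simp add: s_def hopf_def)
  have ns: "norm s = 1" using s by (auto simp: norm_Pair)
  then have h: "norm (hopf s) = 1" using norm_hopf by simp
  have "dist v (hopf s) < 2"
  proof -
    have "v + hopf s \<noteq> 0" using ne by (simp add: eq_neg_iff_add_eq_0)
    then have "(norm (v + hopf s))\<^sup>2 > 0" by simp
    then have "(norm (v - hopf s))\<^sup>2 < 2\<^sup>2"
      using v h by (simp add: power2_norm_eq_inner inner_diff inner_add inner_commute norm_eq_1)
    then show ?thesis by (metis dist_norm power_less_imp_less_base zero_le_numeral)
  qed
  with that hopf_sgn_transport[OF v ns] show ?thesis by blast
qed

lemma phase_unique:
  assumes "norm s = 1" "hopf t = hopf s"
  shows "t = cscale (phase s t) s" "cmod (phase s t) = 1"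
proof -
  have nt: "norm t = 1" using assms norm_hopf[of s] norm_hopf[of t]
    by (metis norm_ge_zero power2_eq_iff_nonneg)
  have e1: "(cmod (fst s))\<^sup>2 + (cmod (snd s))\<^sup>2 = 1" "(cmod (fst t))\<^sup>2 + (cmod (snd t))\<^sup>2 = 1"
    using assms(1) nt norm_pair_sq[of s] norm_pair_sq[of t] by simp_all
  have e2: "(cmod (fst t))\<^sup>2 - (cmod (snd t))\<^sup>2 = (cmod (fst s))\<^sup>2 - (cmod (snd s))\<^sup>2"
    and e3: "fst t * cnj (snd t) = fst s * cnj (snd s)"
    using assms(2) by (simp_all add: hopf_def)
  have "(cmod (fst t))\<^sup>2 = (cmod (fst s))\<^sup>2" "(cmod (snd t))\<^sup>2 = (cmod (snd s))\<^sup>2"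
    using e1 e2 by linarith+
  then have f: "fst t * cnj (fst t) = fst s * cnj (fst s)" "snd t * cnj (snd t) = snd s * cnj (snd s)"
    by (simp_all add: complex_norm_square[symmetric])
  have g: "fst t * cnj (fst t) + snd t * cnj (snd t) = 1"
    using e1(2) by (simp add: complex_norm_square[symmetric] flip: of_real_power of_real_add)
  have e4: "snd t * cnj (fst t) = snd s * cnj (fst s)"
    using arg_cong[OF e3, of cnj] by (simp add: mult.commute)
  have "phase s t * fst s = fst t * (fst s * cnj (fst s)) + snd t * (fst s * cnj (snd s))"
    by (simp add: phase_def algebra_simps)
  also have "\<dots> = fst t * (fst t * cnj (fst t) + snd t * cnj (snd t))"
    unfolding f[symmetric] e3[symmetric] by (simp add: algebra_simps)
  finally have "phase s t * fst s = fst t" by (simp add: g)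
  moreover have "phase s t * snd s = fst t * (snd s * cnj (fst s)) + snd t * (snd s * cnj (snd s))"
    by (simp add: phase_def algebra_simps)
  then have "phase s t * snd s = snd t * (fst t * cnj (fst t) + snd t * cnj (snd t))"
    unfolding f[symmetric] e4[symmetric] by (simp add: algebra_simps)
  then have "phase s t * snd s = snd t" by (simp add: g)
  ultimately show t: "t = cscale (phase s t) s" by (simp add: cscale_def)
  have "(norm t)\<^sup>2 = (cmod (phase s t))\<^sup>2 * (norm s)\<^sup>2"
    by (subst t) (simp add: cscale_def norm_pair_sq norm_mult power_mult_distrib algebra_simps)
  then have "(cmod (phase s t))\<^sup>2 = 1\<^sup>2" using nt assms(1) by simp
  then show "cmod (phase s t) = 1" using power2_eq_iff_nonneg[of "cmod (phase s t)" 1] by simp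
qed

text \<open>
  Lifting through the Hopf fibration over a compact convex set by a discrete parallel transport.
  Fix a lift at a base point and subdivide the segment from there to \<open>p\<close> into \<open>n\<close> equal parts.
  Uniform continuity gives one \<open>n\<close> for which consecutive values of \<open>\<Phi>\<close> are never antipodal, whatever
  \<open>p\<close> is. The resulting \<open>n\<close>-fold composition of transports is then a single formula, continuous in
  \<open>p\<close>.
\<close>

lemma hopf_lift_convex:
  fixes S :: "'a::real_normed_vector set"
  assumes S: "compact S" "convex S" "S \<noteq> {}"
    and cont: "continuous_on S \<Phi>" and unit: "\<And>p. p \<in> S \<Longrightarrow> norm (\<Phi> p) = 1"
  obtains \<Psi> where "continuous_on S \<Psi>" "\<And>p. p \<in> S \<Longrightarrow> norm (\<Psi> p) = 1"
    "\<And>p. p \<in> S \<Longrightarrow> hopf (\<Psi> p) = \<Phi> p"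
proof -
  obtain p0 where p0: "p0 \<in> S" using S by blast
  obtain s0 where s0: "norm s0 = 1" "hopf s0 = \<Phi> p0"
    using hopf_surj_unit unit p0 by metis
  obtain d where d: "d > 0" "\<And>p q. p \<in> S \<Longrightarrow> q \<in> S \<Longrightarrow> dist q p < d \<Longrightarrow> dist (\<Phi> q) (\<Phi> p) < 2"
    using compact_uniformly_continuous[OF cont S(1)]
    unfolding uniformly_continuous_on_def by (metis zero_less_numeral)
  obtain B where B: "\<And>p. p \<in> S \<Longrightarrow> norm (p - p0) \<le> B"
    using compact_imp_bounded[OF S(1)] by (metis bounded_any_center dist_norm dist_commute)
  have B0: "B \<ge> 0" using B[OF p0] by simp
  obtain n :: nat where n: "n > 0" "B < n * d"
    by (metis d(1) ex_less_of_nat_mult gr0I mult_zero_left of_nat_0 B0 not_le)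
  define \<gamma> where "\<gamma> k p = p0 + (real k / n) *\<^sub>R (p - p0)" for k p
  have \<gamma>S: "\<gamma> k p \<in> S" if "k \<le> n" "p \<in> S" for k p
  proof -
    have "\<gamma> k p = (1 - real k / n) *\<^sub>R p0 + (real k / n) *\<^sub>R p"
      by (simp add: \<gamma>_def algebra_simps)
    then show ?thesis using that n p0 convexD_alt[OF S(2) p0 that(2), of "real k / n"] by simp
  qed
  have \<gamma>d: "dist (\<gamma> (Suc k) p) (\<gamma> k p) < d" if "p \<in> S" for k p
  proof -
    have "\<gamma> (Suc k) p - \<gamma> k p = (1 / n) *\<^sub>R (p - p0)"
      by (simp add: \<gamma>_def add_divide_distrib scaleR_left_distrib)
    then have "dist (\<gamma> (Suc k) p) (\<gamma> k p) = norm (p - p0) / n"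
      by (simp add: dist_norm)
    also have "\<dots> \<le> B / n" using B[OF that] by (simp add: divide_right_mono)
    also have "\<dots> < d" using n by (simp add: divide_less_eq mult.commute)
    finally show ?thesis .
  qed
  define L where "L = rec_nat (\<lambda>p. s0) (\<lambda>k s p. sgn (transport (\<Phi> (\<gamma> (Suc k) p)) (s p)))"
  have L0: "L 0 p = s0" and LS: "L (Suc k) p = sgn (transport (\<Phi> (\<gamma> (Suc k) p)) (L k p))" for k p
    by (simp_all add: L_def)
  have main: "continuous_on S (L k) \<and> (\<forall>p\<in>S. norm (L k p) = 1 \<and> hopf (L k p) = \<Phi> (\<gamma> k p))"
    if "k \<le> n" for k
    using that
  proof (induction k)
    case 0
    then show ?case using s0 by (simp add: L0 \<gamma>_def cong: continuous_on_cong)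
  next
    case (Suc k)
    then have IH: "continuous_on S (L k)" "\<And>p. p \<in> S \<Longrightarrow> norm (L k p) = 1"
      "\<And>p. p \<in> S \<Longrightarrow> hopf (L k p) = \<Phi> (\<gamma> k p)" by auto
    have tr: "hopf (L (Suc k) p) = \<Phi> (\<gamma> (Suc k) p)" "norm (L (Suc k) p) = 1"
      "transport (\<Phi> (\<gamma> (Suc k) p)) (L k p) \<noteq> 0" if "p \<in> S" for p
      using hopf_sgn_transport[OF unit[OF \<gamma>S[OF Suc.prems that]] IH(2)[OF that]]
        d(2)[OF \<gamma>S[OF _ that] \<gamma>S[OF Suc.prems that] \<gamma>d[OF that]] IH(3)[OF that] Suc.prems
      by (simp_all add: LS)
    have c: "continuous_on S (\<lambda>p. \<Phi> (\<gamma> (Suc k) p))"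
    proof (rule continuous_on_compose2[OF cont])
      show "continuous_on S (\<gamma> (Suc k))"
        unfolding \<gamma>_def by (intro continuous_intros)
      show "\<gamma> (Suc k) ` S \<subseteq> S" using \<gamma>S Suc.prems by blast
    qed
    have "continuous_on S (\<lambda>p. sgn (transport (\<Phi> (\<gamma> (Suc k) p)) (L k p)))"
      unfolding sgn_div_norm
      by (intro continuous_intros)
        (use tr(3) in \<open>auto simp: transport_def intro!: continuous_intros c IH(1)\<close>)
    then have "continuous_on S (L (Suc k))" by (simp add: LS cong: continuous_on_cong)
    with tr show ?case by blast
  qed
  have "\<gamma> n p = p" for p using n by (simp add: \<gamma>_def)
  with main[of n] that[of "L n"] show ?thesis by auto
qed


section \<open>Antilinear lifts of the two symmetries\<close>

text \<open>
  An antilinear map over \<open>(w, u) \<mapsto> (- w, - \<i> u)\<close>. The latter has order four, but the fourth power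
  of its lift is \<open>- 1\<close>. This sign is intrinsic: by antilinearity a constant phase factor already
  cancels in the square.
\<close>

definition spin_turn :: "complex \<times> complex \<Rightarrow> complex \<times> complex" where
  "spin_turn s = (- \<i> * cnj (snd s), cnj (fst s))"

text \<open>
  An antilinear map over \<open>(w, u) \<mapsto> (w, cnj u)\<close>.
\<close>

definition spin_flip :: "complex \<times> complex \<Rightarrow> complex \<times> complex" where
  "spin_flip s = (cnj (fst s), cnj (snd s))"

lemma norm_spin_turn [simp]: "norm (spin_turn s) = norm s"
  by (simp add: spin_turn_def norm_Pair norm_mult norm_prod_def add.commute)

lemma norm_spin_flip [simp]: "norm (spin_flip s) = norm s"
  by (simp add: spin_flip_def norm_Pair norm_prod_def)

lemma hopf_spin_turn: "hopf (spin_turn s) = (- fst (hopf s), - \<i> * snd (hopf s))"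
  by (simp add: hopf_def spin_turn_def norm_mult)

lemma hopf_spin_flip: "hopf (spin_flip s) = (fst (hopf s), cnj (snd (hopf s)))"
  by (simp add: hopf_def spin_flip_def)

lemma spin_turn_cscale: "spin_turn (cscale c s) = cscale (cnj c) (spin_turn s)"
  by (simp add: spin_turn_def cscale_def)

lemma spin_flip_cscale: "spin_flip (cscale c s) = cscale (cnj c) (spin_flip s)"
  by (simp add: spin_flip_def cscale_def)

lemma cscale_cscale: "cscale c (cscale d s) = cscale (c * d) s"
  by (simp add: cscale_def)

lemma spin_turn_pow4: "spin_turn (spin_turn (spin_turn (spin_turn s))) = cscale (-1) s"
  by (simp add: spin_turn_def cscale_def)

lemma spin_turn_spin_flip_spin_turn: "spin_turn (spin_flip (spin_turn s)) = cscale (- \<i>) (spin_flip s)"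
  by (simp add: spin_turn_def cscale_def spin_flip_def)

lemma spin_flip_spin_flip: "spin_flip (spin_flip s) = s"
  by (simp add: spin_flip_def)

lemma cscale_cancel: "norm s = 1 \<Longrightarrow> cscale c s = cscale d s \<Longrightarrow> c = d"
  by (cases s) (auto simp: cscale_def)

lemma continuous_on_spin_turn [continuous_intros]:
  "continuous_on S f \<Longrightarrow> continuous_on S (\<lambda>x. spin_turn (f x))"
  unfolding spin_turn_def by (intro continuous_intros)

lemma continuous_on_spin_flip [continuous_intros]:
  "continuous_on S f \<Longrightarrow> continuous_on S (\<lambda>x. spin_flip (f x))"
  unfolding spin_flip_def by (intro continuous_intros)

lemma continuous_on_phase [continuous_intros]:
  "continuous_on S f \<Longrightarrow> continuous_on S g \<Longrightarrow> continuous_on S (\<lambda>x. phase (f x) (g x))"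
  unfolding phase_def by (intro continuous_intros)

lemma continuous_on_cscale [continuous_intros]:
  "continuous_on S f \<Longrightarrow> continuous_on S g \<Longrightarrow> continuous_on S (\<lambda>x. cscale (f x) (g x))"
  unfolding cscale_def by (intro continuous_intros)

section \<open>Equivariant lifts and logarithms\<close>

lemma periodic_predicate:
  fixes P :: "real \<Rightarrow> bool"
  assumes "\<And>x. 0 \<le> x \<Longrightarrow> x \<le> 1 \<Longrightarrow> P x" and step: "\<And>x. P (x + 1) = P x"
  shows "P x"
proof -
  have "P (frac x + of_int k)" for k
  proof (induction k rule: int_induct[where k = 0])
    case base
    show ?case using assms(1)[of "frac x"] frac_lt_1[of x] by simp
  next
    case (step1 i)
    then show ?case using step[of "frac x + of_int i"] by (simp add: add.assoc)
  next
    case (step2 i)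
    then show ?case using step[of "frac x + of_int (i - 1)"] by (simp add: add.assoc)
  qed
  from this[of "\<lfloor>x\<rfloor>"] show ?thesis by (simp add: frac_def)
qed

text \<open>
  A map on a slab of width one whose two faces match under \<open>J\<close> continues to all of \<open>\<real>\<close> by applying
  powers of \<open>J\<close>. Since \<open>J\<close> has finite order, exponents reduced modulo that order also handle the
  negative direction, without inverses.
\<close>

lemma equivariant_extension:
  fixes g :: "'a::metric_space \<times> real \<Rightarrow> 'b::topological_space" and J :: "'b \<Rightarrow> 'b"
  assumes D: "closed D" and g: "continuous_on (D \<times> {0..1}) g"
    and J: "continuous_on UNIV J" and m: "m > 0" "J ^^ m = id"
    and glue: "\<And>z. z \<in> D \<Longrightarrow> g (z, 1) = J (g (z, 0))"
  obtains G where "continuous_on (D \<times> UNIV) G"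
    "\<And>z x. z \<in> D \<Longrightarrow> G (z, x + 1) = J (G (z, x))"
    "\<And>z x. z \<in> D \<Longrightarrow> 0 \<le> x \<Longrightarrow> x \<le> 1 \<Longrightarrow> G (z, x) = g (z, x)"
proof
  define e where "e k = J ^^ nat (k mod int m)" for k
  have eS: "e (k + 1) s = J (e k s)" for k s
  proof -
    define r where "r = k mod int m"
    have r: "0 \<le> r" "r < int m" using m(1) by (simp_all add: r_def)
    have k1: "(k + 1) mod int m = (r + 1) mod int m" by (simp add: r_def mod_add_left_eq)
    have "(r + 1) mod int m = (if r + 1 = int m then 0 else r + 1)"
      using r by (auto intro: mod_pos_pos_trivial)
    moreover have "J (e k s) = (J ^^ nat (r + 1)) s"
      using r by (simp add: e_def r_def[symmetric] nat_add_distrib)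
    ultimately show ?thesis using m(2) by (auto simp: e_def k1)
  qed
  have econt: "continuous_on UNIV (e k)" for k
  proof -
    have "continuous_on UNIV (J ^^ n)" for n
      by (induction n) (auto intro: continuous_on_compose2[OF J] simp: comp_def id_def)
    then show ?thesis by (simp add: e_def)
  qed
  define G where "G p = e \<lfloor>snd p\<rfloor> (g (fst p, snd p - of_int \<lfloor>snd p\<rfloor>))" for p
  have Gk: "G (z, x) = e k (g (z, x - of_int k))" if "z \<in> D" "of_int k \<le> x" "x \<le> of_int k + 1" for z x k
  proof (cases "x = of_int k + 1")
    case True
    then have "G (z, x) = e (k + 1) (g (z, 0))" by (simp add: G_def)
    also have "\<dots> = e k (J (g (z, 0)))"
      by (simp only: eS) (simp add: e_def funpow_swap1)
    finally show ?thesis using True glue[OF that(1)] by simp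
  next
    case False
    then have "\<lfloor>x\<rfloor> = k" using that by (simp add: floor_eq_iff)
    then show ?thesis by (simp add: G_def)
  qed
  show "G (z, x) = g (z, x)" if "z \<in> D" "0 \<le> x" "x \<le> 1" for z x
    using Gk[of z 0 x] that by (simp add: e_def)
  show "G (z, x + 1) = J (G (z, x))" if "z \<in> D" for z x
    using eS by (simp add: G_def)
  have slab: "continuous_on (D \<times> {of_int k..of_int k + 1}) G" for k
  proof -
    have "continuous_on (D \<times> {of_int k..of_int k + 1}) (\<lambda>p. e k (g (fst p, snd p - of_int k)))"
      by (intro continuous_on_compose2[OF econt] continuous_on_compose2[OF g] continuous_intros) auto
    then show ?thesis
      by (rule continuous_on_eq) (auto simp: Gk)
  qed
  show "continuous_on (D \<times> UNIV) G"
    unfolding continuous_on_eq_continuous_within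
  proof clarify
    fix z and x :: real assume z: "z \<in> D"
    define k where "k = \<lfloor>x\<rfloor>"
    \<comment> \<open>The slab that contains \<open>x\<close> and the one before it together form a neighbourhood, even if \<open>x\<close> is an integer.\<close>
    define T where "T = D \<times> {of_int (k - 1)..of_int (k - 1) + (1::real)} \<union> D \<times> {of_int k..of_int k + (1::real)}"
    have "continuous_on T G"
      unfolding T_def using D by (intro continuous_on_closed_Un slab closed_Times) auto
    moreover have k: "of_int k \<le> x" "x < of_int k + 1" unfolding k_def by linarith+
    then have "(z, x) \<in> T" using z by (auto simp: T_def)
    ultimately have "continuous (at (z, x) within T) G"
      by (simp add: continuous_on_eq_continuous_within)
    moreover have "at (z, x) within T = at (z, x) within D \<times> UNIV"
      by (rule at_within_nhd[of _ "UNIV \<times> {of_int (k - 1)<..<of_int k + 1}"])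
        (use k in \<open>auto simp: T_def intro!: open_Times\<close>)
    ultimately show "continuous (at (z, x) within D \<times> UNIV) G" by simp
  qed
qed

text \<open>
  The values of \<open>f\<close> on the connected set \<open>S\<close> lie in a coset of the discrete group \<open>2 \<pi> \<i> \<int>\<close>.
\<close>

lemma exp_const_imp_const:
  fixes f :: "'a::topological_space \<Rightarrow> complex"
  assumes "connected S" "continuous_on S f" "\<And>x. x \<in> S \<Longrightarrow> exp (f x) = c"
    and xy: "x \<in> S" "y \<in> S"
  shows "f x = f y"
proof -
  have "f constant_on S"
  proof (rule continuous_discrete_range_constant[OF assms(1,2)])
    fix x assume x: "x \<in> S"
    have "2 * pi \<le> norm (f y - f x)" if y: "y \<in> S" "f y \<noteq> f x" for y
    proof -
      have "exp (f y) = exp (f x)" using assms(3) x y by simp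
      then obtain n :: int where n: "f y = f x + (of_int (2 * n) * pi) * \<i>"
        by (auto simp: exp_eq)
      with y have "n \<noteq> 0" by auto
      then have "1 \<le> \<bar>real_of_int n\<bar>" by linarith
      then have "2 * pi * 1 \<le> 2 * pi * \<bar>real_of_int n\<bar>" by (intro mult_left_mono) auto
      then show ?thesis using n by (simp add: norm_mult algebra_simps)
    qed
    then show "\<exists>e>0. \<forall>y. y \<in> S \<and> f y \<noteq> f x \<longrightarrow> e \<le> norm (f y - f x)"
      by (intro exI[of _ "2 * pi"]) auto
  qed
  then show ?thesis using xy by (auto simp: constant_on_def)
qed

text \<open>
  A lift over \<open>D \<times> [0, 1]\<close> satisfies the turning relation only up to a phase \<open>l z\<close>. As \<open>D\<close> is
  contractible this phase has a logarithm \<open>h\<close>, and multiplying the lift by \<open>exp (x h z)\<close> interpolates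
  between no correction on one face and the full correction on the other. The corrected lift then
  extends to \<open>D \<times> \<real>\<close>.
\<close>

lemma equivariant_hopf_lift:
  fixes \<Phi> :: "'a::euclidean_space \<times> real \<Rightarrow> real \<times> complex"
  assumes D: "compact D" "convex D" "D \<noteq> {}"
    and cont: "continuous_on (D \<times> UNIV) \<Phi>"
    and unit: "\<And>z x. z \<in> D \<Longrightarrow> norm (\<Phi> (z, x)) = 1"
    and turn: "\<And>z x. z \<in> D \<Longrightarrow> \<Phi> (z, x + 1) = (- fst (\<Phi> (z, x)), - \<i> * snd (\<Phi> (z, x)))"
  obtains \<Psi> where "continuous_on (D \<times> UNIV) \<Psi>"
    "\<And>z x. z \<in> D \<Longrightarrow> norm (\<Psi> (z, x)) = 1"
    "\<And>z x. z \<in> D \<Longrightarrow> hopf (\<Psi> (z, x)) = \<Phi> (z, x)"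
    "\<And>z x. z \<in> D \<Longrightarrow> \<Psi> (z, x + 1) = spin_turn (\<Psi> (z, x))"
proof -
  have "compact (D \<times> {0..1::real})" "convex (D \<times> {0..1::real})" "D \<times> {0..1::real} \<noteq> {}"
    using D by (auto intro: compact_Times convex_Times)
  moreover have "continuous_on (D \<times> {0..1}) \<Phi>" using cont by (rule continuous_on_subset) auto
  moreover have "norm (\<Phi> p) = 1" if "p \<in> D \<times> {0..1}" for p using that unit by auto
  ultimately obtain g0 where g0: "continuous_on (D \<times> {0..1}) g0"
    and "\<And>p. p \<in> D \<times> {0..1} \<Longrightarrow> norm (g0 p) = 1"
    and "\<And>p. p \<in> D \<times> {0..1} \<Longrightarrow> hopf (g0 p) = \<Phi> p"
    by (rule hopf_lift_convex) (assumption, rule that)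
  then have g0n: "norm (g0 (z, x)) = 1" and g0h: "hopf (g0 (z, x)) = \<Phi> (z, x)"
    if "z \<in> D" "0 \<le> x" "x \<le> 1" for z x
    using that by auto
  define l where "l z = phase (g0 (z, 1)) (spin_turn (g0 (z, 0)))" for z
  have "hopf (spin_turn (g0 (z, 0))) = hopf (g0 (z, 1))" if "z \<in> D" for z
    using that turn[OF that, of 0] by (simp add: hopf_spin_turn g0h)
  then have l: "spin_turn (g0 (z, 0)) = cscale (l z) (g0 (z, 1))" "cmod (l z) = 1" if "z \<in> D" for z
    unfolding l_def using that by (intro phase_unique g0n; simp)+
  have "continuous_on D l"
    unfolding l_def by (intro continuous_intros continuous_on_compose2[OF g0]) auto
  moreover have "l z \<noteq> 0" if "z \<in> D" for z using l(2)[OF that] by auto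
  ultimately obtain h where h: "continuous_on D h" "\<And>z. z \<in> D \<Longrightarrow> l z = exp (h z)"
    by (rule continuous_logarithm_on_contractible[OF _ convex_imp_contractible[OF D(2)]]) (assumption, rule that)
  have Reh: "Re (h z) = 0" if "z \<in> D" for z
    using l(2)[OF that] h(2)[OF that] by simp
  define g where "g p = cscale (exp (of_real (snd p) * h (fst p))) (g0 p)" for p
  have gn: "norm (g (z, x)) = 1 \<and> hopf (g (z, x)) = \<Phi> (z, x)" if "z \<in> D" "0 \<le> x" "x \<le> 1" for z x
  proof -
    have "cmod (exp (of_real x * h z)) = 1" using Reh that by simp
    then have "hopf (g (z, x)) = \<Phi> (z, x)" using that by (simp add: g_def hopf_cscale g0h)
    moreover from this have "(norm (g (z, x)))\<^sup>2 = 1" using unit[OF that(1)] by (metis norm_hopf)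
    ultimately show ?thesis using power2_eq_1_iff[of "norm (g (z, x))"] norm_ge_zero[of "g (z, x)"] by linarith
  qed
  have "continuous_on (D \<times> {0..1}) g"
    unfolding g_def by (intro continuous_intros g0 continuous_on_compose2[OF h(1)]) auto
  moreover have "g (z, 1) = spin_turn (g (z, 0))" if "z \<in> D" for z
    using that by (simp add: g_def l(1) h(2)[symmetric]) (simp add: cscale_def l(1)[unfolded cscale_def, symmetric])
  moreover have "spin_turn ^^ 8 = id"
    by (auto simp: fun_eq_iff numeral_eq_Suc spin_turn_pow4 cscale_def)
  moreover have "continuous_on UNIV spin_turn" using continuous_on_spin_turn[OF continuous_on_id] .
  ultimately obtain G where G: "continuous_on (D \<times> UNIV) G"
    "\<And>z x. z \<in> D \<Longrightarrow> G (z, x + 1) = spin_turn (G (z, x))"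
    "\<And>z x. z \<in> D \<Longrightarrow> 0 \<le> x \<Longrightarrow> x \<le> 1 \<Longrightarrow> G (z, x) = g (z, x)"
    using equivariant_extension[OF compact_imp_closed[OF D(1)], of g spin_turn 8] by auto
  have "norm (G (z, x)) = 1 \<and> hopf (G (z, x)) = \<Phi> (z, x)" if z: "z \<in> D" for z x
  proof (rule periodic_predicate[where P = "\<lambda>x. norm (G (z, x)) = 1 \<and> hopf (G (z, x)) = \<Phi> (z, x)"])
    fix x :: real
    show "0 \<le> x \<Longrightarrow> x \<le> 1 \<Longrightarrow> norm (G (z, x)) = 1 \<and> hopf (G (z, x)) = \<Phi> (z, x)"
      using gn z G(3) by simp
    show "(norm (G (z, x + 1)) = 1 \<and> hopf (G (z, x + 1)) = \<Phi> (z, x + 1)) =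
      (norm (G (z, x)) = 1 \<and> hopf (G (z, x)) = \<Phi> (z, x))"
      using z by (auto simp: G(2) turn hopf_spin_turn prod_eq_iff)
  qed
  with G that show ?thesis by blast
qed

section \<open>The obstruction\<close>

text \<open>
  The topological heart. If \<open>\<Phi>\<close> had no zero, its normalization would have a lift \<open>\<Psi>\<close> commuting with the
  quarter turn. On the boundary circle the flip relates \<open>\<Psi>\<close> to itself up to a phase \<open>\<mu>\<close>, a function on
  the plane of pairs \<open>(t, x)\<close>. Comparing the flip with the turn gives
  \<open>\<mu> (t, x + 1) * \<mu> (t, x) = - \<i>\<close>, and applying the flip twice is four turns, whose lift is \<open>- 1\<close>, so
  \<open>\<mu> (t + 2, 2 * t - x) = - \<mu> (t, x)\<close>. For a continuous logarithm \<open>\<gamma>\<close> of \<open>\<mu>\<close> this says that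
  \<open>\<gamma> (t, x + 1) + \<gamma> (t, x)\<close> is a constant \<open>A\<close> and \<open>\<gamma> (t + 2, 2 * t - x) - \<gamma> (t, x)\<close> is a constant \<open>B\<close>
  with \<open>exp B = - 1\<close>. Substituting the second relation into the first gives \<open>A + 2 B = A\<close>, hence
  \<open>B = 0\<close>, which is absurd.

  The disc enters because it makes \<open>\<Psi>\<close> depend on the boundary point alone, and not on
  the real number \<open>t\<close> that parametrizes it; this is used in the second relation.
\<close>

theorem twisted_map_has_zero:
  fixes \<Phi> :: "complex \<times> real \<Rightarrow> real \<times> complex"
  assumes cont: "continuous_on (cball 0 1 \<times> UNIV) \<Phi>"
    and turn: "\<And>z x. z \<in> cball 0 1 \<Longrightarrow>
      \<Phi> (z, x + 1) = (- fst (\<Phi> (z, x)), - \<i> * snd (\<Phi> (z, x)))"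
    and flip: "\<And>t x. \<Phi> (- cis (pi * t / 2), 2 * t - x) =
      (fst (\<Phi> (cis (pi * t / 2), x)), cnj (snd (\<Phi> (cis (pi * t / 2), x))))"
  obtains z x where "z \<in> cball 0 1" "\<Phi> (z, x) = 0"
proof (rule ccontr)
  assume "\<not> thesis"
  with that have nz: "\<Phi> (z, x) \<noteq> 0" if "z \<in> cball 0 1" for z x using that by blast
  define \<Theta> where "\<Theta> p = sgn (\<Phi> p)" for p
  have nrm: "norm (- w, - \<i> * u) = norm (w, u)" "norm (w, cnj u) = norm (w, u)" for w :: real and u
    by (simp_all add: norm_Pair norm_mult)
  have "continuous_on (cball 0 1 \<times> UNIV) \<Theta>"
    unfolding \<Theta>_def sgn_div_norm by (intro continuous_intros cont) (use nz in auto)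
  moreover have "norm (\<Theta> (z, x)) = 1" if "z \<in> cball 0 1" for z x
    using nz that by (simp add: \<Theta>_def norm_sgn)
  moreover have "\<Theta> (z, x + 1) = (- fst (\<Theta> (z, x)), - \<i> * snd (\<Theta> (z, x)))"
    if "z \<in> cball 0 1" for z x
    using turn[OF that, of x] nrm(1)[of "fst (\<Phi> (z, x))" "snd (\<Phi> (z, x))"]
    by (simp add: \<Theta>_def sgn_div_norm)
  moreover have "cball (0::complex) 1 \<noteq> {}" by simp
  ultimately obtain \<Psi> where \<Psi>: "continuous_on (cball 0 1 \<times> UNIV) \<Psi>"
    and \<Psi>n: "\<And>z x. z \<in> cball 0 1 \<Longrightarrow> norm (\<Psi> (z, x)) = 1"
    and \<Psi>h: "\<And>z x. z \<in> cball 0 1 \<Longrightarrow> hopf (\<Psi> (z, x)) = \<Theta> (z, x)"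
    and \<Psi>J: "\<And>z x. z \<in> cball 0 1 \<Longrightarrow> \<Psi> (z, x + 1) = spin_turn (\<Psi> (z, x))"
    by (elim equivariant_hopf_lift[OF compact_cball convex_cball, rotated]) blast+
  define c where "c t = cis (pi * t / 2)" for t
  have cb: "c t \<in> cball 0 1" "- c t \<in> cball 0 1" for t by (simp_all add: c_def)
  have c2: "c (t + 2) = - c t" for t
    by (simp add: c_def complex_eq_iff distrib_left add_divide_distrib)
  have flip': "\<Theta> (- c t, 2 * t - x) = (fst (\<Theta> (c t, x)), cnj (snd (\<Theta> (c t, x))))" for t x
    using flip[of t x] nrm(2)[of "fst (\<Phi> (c t, x))" "snd (\<Phi> (c t, x))"]
    by (simp add: \<Theta>_def sgn_div_norm c_def)
  define \<mu> where "\<mu> p = phase (spin_flip (\<Psi> (c (fst p), snd p))) (\<Psi> (- c (fst p), 2 * fst p - snd p))" for p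
  have "hopf (\<Psi> (- c t, 2 * t - x)) = hopf (spin_flip (\<Psi> (c t, x)))" for t x
    using cb by (simp add: \<Psi>h hopf_spin_flip flip')
  then have \<mu>: "\<Psi> (- c t, 2 * t - x) = cscale (\<mu> (t, x)) (spin_flip (\<Psi> (c t, x)))" "cmod (\<mu> (t, x)) = 1" for t x
    unfolding \<mu>_def fst_conv snd_conv using \<Psi>n[OF cb(1)] by (intro phase_unique; simp)+
  have \<mu>nz: "\<mu> p \<noteq> 0" for p using \<mu>(2)[of "fst p" "snd p"] by auto
  have "continuous_on UNIV c" unfolding c_def by (auto intro!: continuous_intros)
  note cc = continuous_on_compose2[OF this]
  have "continuous_on UNIV \<mu>"
    unfolding \<mu>_def by (intro continuous_intros continuous_on_compose2[OF \<Psi>] cc) (use cb in auto)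
  then obtain \<gamma> where \<gamma>: "continuous_on UNIV \<gamma>" and "\<And>p. p \<in> UNIV \<Longrightarrow> \<mu> p = exp (\<gamma> p)"
    by (rule continuous_logarithm_on_contractible[OF _ convex_imp_contractible[OF convex_UNIV] \<mu>nz])
      (rule that)
  then have \<gamma>e: "\<mu> p = exp (\<gamma> p)" for p by simp
  have \<mu>a: "\<mu> (t, x + 1) * \<mu> (t, x) = - \<i>" for t x
  proof -
    have "cscale (\<mu> (t, x)) (spin_flip (\<Psi> (c t, x))) = spin_turn (\<Psi> (- c t, 2 * t - (x + 1)))"
      using \<Psi>J[OF cb(2)[of t], of "2 * t - (x + 1)"] by (simp flip: \<mu>(1))
    also have "\<dots> = cscale (cnj (\<mu> (t, x + 1)) * - \<i>) (spin_flip (\<Psi> (c t, x)))"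
      unfolding \<mu>(1) by (simp add: \<Psi>J[OF cb(1)] spin_turn_cscale spin_turn_spin_flip_spin_turn cscale_cscale)
    finally have "\<mu> (t, x) = cnj (\<mu> (t, x + 1)) * - \<i>"
      by (rule cscale_cancel[rotated]) (simp add: \<Psi>n[OF cb(1)])
    moreover have "\<mu> (t, x + 1) * cnj (\<mu> (t, x + 1)) = 1"
      using \<mu>(2)[of t "x + 1"] by (simp add: complex_norm_square[symmetric])
    ultimately show ?thesis by (metis mult.assoc mult_1)
  qed
  have \<mu>b: "\<mu> (t + 2, 2 * t - x) = - \<mu> (t, x)" for t x
  proof -
    \<comment> \<open>After two flips the boundary point is the old one, while \<open>x\<close> has increased by 4.\<close>
    have "\<Psi> (c t, x + 1 + 1 + 1 + 1) = cscale (-1) (\<Psi> (c t, x))"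
      unfolding \<Psi>J[OF cb(1)] by (rule spin_turn_pow4)
    moreover have "\<Psi> (- c (t + 2), 2 * (t + 2) - (2 * t - x)) =
        cscale (\<mu> (t + 2, 2 * t - x) * cnj (\<mu> (t, x))) (\<Psi> (c t, x))"
      unfolding \<mu>(1)[of "t + 2"] unfolding c2 \<mu>(1) by (simp add: spin_flip_cscale spin_flip_spin_flip cscale_cscale)
    ultimately have "cscale (\<mu> (t + 2, 2 * t - x) * cnj (\<mu> (t, x))) (\<Psi> (c t, x)) = cscale (-1) (\<Psi> (c t, x))"
      by (simp add: c2 algebra_simps)
    then have "\<mu> (t + 2, 2 * t - x) * cnj (\<mu> (t, x)) = -1"
      by (rule cscale_cancel[rotated]) (simp add: \<Psi>n[OF cb(1)])
    moreover have "cnj (\<mu> (t, x)) * \<mu> (t, x) = 1"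
      using \<mu>(2)[of t x] by (simp add: complex_norm_square[symmetric] mult.commute)
    ultimately show ?thesis by (metis mult.assoc mult_1_right mult_minus1)
  qed
  define A where "A p = \<gamma> (fst p, snd p + 1) + \<gamma> p" for p
  define B where "B p = \<gamma> (fst p + 2, 2 * fst p - snd p) - \<gamma> p" for p
  have "continuous_on UNIV A" "continuous_on UNIV B" unfolding A_def B_def
    by (intro continuous_intros continuous_on_compose2[OF \<gamma>]; simp)+
  moreover have "exp (A p) = - \<i>" "exp (B p) = - 1" for p
    using \<mu>a[of "fst p" "snd p"] \<mu>b[of "fst p" "snd p"] \<mu>nz[of p]
    by (simp_all add: A_def B_def exp_add exp_diff flip: \<gamma>e)
  ultimately have "A p = A q" "B p = B q" "exp (B p) = -1" for p q
    using exp_const_imp_const[OF connected_UNIV, of A] exp_const_imp_const[OF connected_UNIV, of B]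
    by blast+
  note * = this
  \<comment> \<open>The flip sends \<open>(0, 0)\<close> and \<open>(0, 1)\<close> to \<open>(2, 0)\<close> and \<open>(2, -1)\<close>, which again differ by one turn.\<close>
  have "2 * B (0, 0) = B (0, 0) + B (0, 1)" using *(2)[of "(0, 1)" "(0, 0)"] by simp
  also have "\<dots> = A (2, -1) - A (0, 0)" by (simp add: A_def B_def)
  also have "\<dots> = 0" using *(1)[of "(2, -1)" "(0, 0)"] by simp
  finally have "B (0, 0) = 0" by simp
  then show False using *(3)[of "(0, 0)"] by simp
qed


section \<open>Moving frames over a hemisphere\<close>

definition orthonormal3 :: "real^3 \<Rightarrow> real^3 \<Rightarrow> real^3 \<Rightarrow> bool" where
  "orthonormal3 i j k \<longleftrightarrow> norm i = 1 \<and> norm j = 1 \<and> norm k = 1 \<and> i \<bullet> j = 0 \<and> j \<bullet> k = 0 \<and> i \<bullet> k = 0"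

definition height :: "complex \<Rightarrow> real" where
  "height z = sqrt (1 - (cmod z)\<^sup>2)"

text \<open>
  The unit disc of \<open>\<complex>\<close> parametrizes the closed upper hemisphere by orthogonal projection. The frame at a point
  is the image of the standard basis under the rotation along the great circle from the north pole
  to that point, so that \<open>frame3\<close> is the point itself.
\<close>

definition frame1 :: "complex \<Rightarrow> real^3" where
  "frame1 z = vector [1 - (Re z)\<^sup>2 / (1 + height z), - (Re z * Im z) / (1 + height z), - Re z]"

definition frame2 :: "complex \<Rightarrow> real^3" where
  "frame2 z = vector [- (Re z * Im z) / (1 + height z), 1 - (Im z)\<^sup>2 / (1 + height z), - Im z]"

definition frame3 :: "complex \<Rightarrow> real^3" where
  "frame3 z = vector [Re z, Im z, height z]"

lemma inner_vector3: "vector [a, b, c] \<bullet> (vector [x, y, z] :: real^3) = a * x + b * y + c * z"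
  by (simp add: inner_vec_def sum_3)

lemma continuous_on_vector3 [continuous_intros]:
  assumes "continuous_on S f" "continuous_on S g" "continuous_on S h"
  shows "continuous_on S (\<lambda>x. vector [f x, g x, h x] :: real^3)"
proof -
  have "vector [f x, g x, h x] = ((\<chi> i. if i = 1 then f x else if i = 2 then g x else h x) :: real^3)" for x
    by (simp add: vec_eq_iff forall_3)
  moreover have "continuous_on S (\<lambda>x. if i = 1 then f x else if i = 2 then g x else h x)" for i :: 3
    using assms by (cases "i = 1"; cases "i = 2") simp_all
  ultimately show ?thesis
    by (simp add: continuous_on_vec_lambda)
qed

lemma height_nonneg: "z \<in> cball 0 1 \<Longrightarrow> 0 \<le> height z"
  by (simp add: height_def abs_square_le_1)

lemma height_sq: "z \<in> cball 0 1 \<Longrightarrow> (Re z)\<^sup>2 + (Im z)\<^sup>2 + (height z)\<^sup>2 = 1"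
  by (simp add: height_def abs_square_le_1 cmod_power2[symmetric])

lemma frame_orthonormal:
  assumes "z \<in> cball 0 1"
  shows "orthonormal3 (frame1 z) (frame2 z) (frame3 z)"
proof -
  define p q h where "p = Re z" and "q = Im z" and "h = height z"
  define r where "r = inverse (1 + h)"
  have e: "p * p + q * q + h * h = 1" using height_sq[OF assms] by (simp add: p_def q_def h_def power2_eq_square)
  have "1 + h \<noteq> 0" using height_nonneg[OF assms] by (simp add: h_def)
  then have r: "r * (1 + h) = 1" by (simp add: r_def)
  have "frame1 z = vector [1 - p * p * r, - (p * q) * r, - p]"
    "frame2 z = vector [- (p * q) * r, 1 - q * q * r, - q]" "frame3 z = vector [p, q, h]"
    by (simp_all add: frame1_def frame2_def frame3_def p_def q_def h_def r_def power2_eq_square divide_inverse)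
  moreover have "(1 - p * p * r) * (1 - p * p * r) + (- (p * q) * r) * (- (p * q) * r) + - p * - p = 1"
    "(- (p * q) * r) * (- (p * q) * r) + (1 - q * q * r) * (1 - q * q * r) + - q * - q = 1"
    "(1 - p * p * r) * (- (p * q) * r) + (- (p * q) * r) * (1 - q * q * r) + - p * - q = 0"
    "(- (p * q) * r) * p + (1 - q * q * r) * q + - q * h = 0"
    "(1 - p * p * r) * p + (- (p * q) * r) * q + - p * h = 0"
    using e r by algebra+
  ultimately show ?thesis
    using e by (simp add: orthonormal3_def norm_eq_1 inner_vector3)
qed

lemma continuous_on_frame:
  "continuous_on (cball 0 1) frame1" "continuous_on (cball 0 1) frame2" "continuous_on (cball 0 1) frame3"
proof -
  have h: "continuous_on (cball 0 1) height" unfolding height_def by (intro continuous_intros)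
  have "1 + height z \<noteq> 0" if "z \<in> cball 0 1" for z using height_nonneg[OF that] by simp
  then show "continuous_on (cball 0 1) frame1" "continuous_on (cball 0 1) frame2"
    "continuous_on (cball 0 1) frame3"
    unfolding frame1_def frame2_def frame3_def by (intro continuous_intros h; simp)+
qed

lemma frame_equator:
  "cos \<theta> *\<^sub>R frame1 (cis a) + sin \<theta> *\<^sub>R frame2 (cis a) =
     vector [sin a * sin (a - \<theta>), - cos a * sin (a - \<theta>), - cos (a - \<theta>)]"
  "frame3 (cis a) = vector [cos a, sin a, 0]"
proof -
  have h: "height (cis a) = 0" by (simp add: height_def)
  show "frame3 (cis a) = vector [cos a, sin a, 0]" by (simp add: frame3_def h)
  have s: "1 - (cos a)\<^sup>2 = (sin a)\<^sup>2" "1 - (sin a)\<^sup>2 = (cos a)\<^sup>2"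
    by (simp_all add: cos_squared_eq)
  show "cos \<theta> *\<^sub>R frame1 (cis a) + sin \<theta> *\<^sub>R frame2 (cis a) =
     vector [sin a * sin (a - \<theta>), - cos a * sin (a - \<theta>), - cos (a - \<theta>)]"
    by (simp add: vec_eq_iff forall_3 frame1_def frame2_def h s sin_diff cos_diff)
      (simp add: power2_eq_square algebra_simps)
qed

text \<open>
  Over the equator the tangent direction at angle \<open>x\<close>, measured in quarter turns, can be compared with
  the frame at the antipodal point. That frame is turned relative to the first one by an amount depending
  on the base point, which explains the reparametrization \<open>2 * t - x\<close> of the angle.
\<close>

lemma frame_antipode:
  fixes t x :: real
  defines "z \<equiv> cis (pi * t / 2)"
  shows "cos (pi * (2 * t - x) / 2) *\<^sub>R frame1 (- z) + sin (pi * (2 * t - x) / 2) *\<^sub>R frame2 (- z) =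
     - (cos (pi * x / 2) *\<^sub>R frame1 z + sin (pi * x / 2) *\<^sub>R frame2 z)"
    "frame3 (- z) = - frame3 z"
proof -
  define a where "a = pi * t / 2"
  have m: "- z = cis (a + pi)" by (simp add: z_def a_def complex_eq_iff)
  have z: "z = cis a" by (simp add: z_def a_def)
  have "a + pi - pi * (2 * t - x) / 2 = pi - (a - pi * x / 2)"
    by (simp add: a_def field_simps)
  then have "sin (a + pi - pi * (2 * t - x) / 2) = sin (a - pi * x / 2)"
    "cos (a + pi - pi * (2 * t - x) / 2) = - cos (a - pi * x / 2)"
    by (simp_all only: sin_pi_minus cos_pi_minus)
  then show "cos (pi * (2 * t - x) / 2) *\<^sub>R frame1 (- z) + sin (pi * (2 * t - x) / 2) *\<^sub>R frame2 (- z) =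
     - (cos (pi * x / 2) *\<^sub>R frame1 z + sin (pi * x / 2) *\<^sub>R frame2 z)"
    unfolding m unfolding z frame_equator by (simp add: vec_eq_iff forall_3)
  show "frame3 (- z) = - frame3 z"
    unfolding m unfolding z frame_equator by (simp add: vec_eq_iff forall_3)
qed

lemma orthonormal3_rotate:
  assumes "orthonormal3 i j k"
  shows "orthonormal3 (cos \<theta> *\<^sub>R i + sin \<theta> *\<^sub>R j) (- sin \<theta> *\<^sub>R i + cos \<theta> *\<^sub>R j) k"
proof -
  have "cos \<theta> * cos \<theta> + sin \<theta> * sin \<theta> = 1" using sin_cos_squared_add3 by blast
  then show ?thesis
    using assms by (simp add: orthonormal3_def norm_eq_1 inner_add inner_commute algebra_simps)
qed

lemma norm_combination:
  assumes "orthonormal3 i j k" "c\<^sup>2 + s\<^sup>2 = 1"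
  shows "norm (c *\<^sub>R k + s *\<^sub>R i) = 1"
  using assms by (simp add: orthonormal3_def norm_eq_1 inner_add inner_commute power2_eq_square)

text \<open>
  For each frame, \<open>F\<close> takes four values on the upper square of the box. Their alternating sum
  together with their two diagonal differences is a map to \<open>\<real> \<times> \<complex>\<close> that vanishes exactly if they are equal.
  Turning the frame permutes the values cyclically. Over the equator the box at a point and the box at the
  antipode have the same vertices up to sign; because \<open>F\<close> is even this exchanges two opposite corners
  and fixes the other two. These are the symmetries that force a zero.
\<close>

theorem even_function_balanced_square:
  fixes F :: "real^3 \<Rightarrow> real"
  assumes cont: "continuous_on (sphere 0 1) F"
    and even: "\<And>x. x \<in> sphere 0 1 \<Longrightarrow> F x = F (- x)"
    and cs: "c\<^sup>2 + s\<^sup>2 = 1"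
  obtains i j k r where "orthonormal3 i j k" "F (c *\<^sub>R k + s *\<^sub>R i) = r" "F (c *\<^sub>R k - s *\<^sub>R i) = r"
    "F (c *\<^sub>R k + s *\<^sub>R j) = r" "F (c *\<^sub>R k - s *\<^sub>R j) = r"
proof -
  define I where "I z x = cos (pi * x / 2) *\<^sub>R frame1 z + sin (pi * x / 2) *\<^sub>R frame2 z" for z x
  define V where "V p = c *\<^sub>R frame3 (fst p) + s *\<^sub>R I (fst p) (snd p)" for p
  define f where "f z x = F (V (z, x))" for z x
  have I1: "I z (x + 1) = - sin (pi * x / 2) *\<^sub>R frame1 z + cos (pi * x / 2) *\<^sub>R frame2 z" for z x
  proof -
    have "pi * (x + 1) / 2 = pi * x / 2 + pi / 2" by (simp add: field_simps)
    then show ?thesis unfolding I_def by (simp only: cos_add sin_add) simp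
  qed
  have I2: "I z (x + 2) = - I z x" for z x
  proof -
    have "pi * (x + 2) / 2 = pi * x / 2 + pi" by (simp add: field_simps)
    then show ?thesis unfolding I_def by (simp only: cos_periodic_pi sin_periodic_pi) simp
  qed
  have I3: "I z (x + 3) = - I z (x + 1)" for z x using I2[of z "x + 1"] by (simp add: add.assoc)
  have on: "orthonormal3 (I z x) (I z (x + 1)) (frame3 z)" if "z \<in> cball 0 1" for z x
    unfolding I1 unfolding I_def by (rule orthonormal3_rotate[OF frame_orthonormal[OF that]])
  have V: "V (z, x) \<in> sphere 0 1" if "z \<in> cball 0 1" for z x
    using norm_combination[OF on[OF that] cs] by (simp add: V_def)
  have f4: "f z (x + 4) = f z x" for z x
    using I2[of z x] I2[of z "x + 2"] by (simp add: f_def V_def add.assoc)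
  have fa: "f (- cis (pi * t / 2)) (2 * t - x) = f (cis (pi * t / 2)) x" for t x
  proof -
    have "V (- cis (pi * t / 2), 2 * t - x) = - V (cis (pi * t / 2), x)"
      unfolding V_def I_def fst_conv snd_conv frame_antipode
      by (simp add: scaleR_right_distrib scaleR_diff_right)
    then show ?thesis unfolding f_def by (simp only:) (rule even[symmetric], rule V, simp)
  qed
  have cf: "continuous_on (cball 0 1 \<times> UNIV) (\<lambda>p. f (fst p) (snd p + d))" for d
  proof -
    have "continuous_on (cball 0 1 \<times> UNIV) (\<lambda>p. V (fst p, snd p + d))"
      unfolding V_def I_def fst_conv snd_conv
      by (intro continuous_intros continuous_on_compose2[OF continuous_on_frame(1)]
          continuous_on_compose2[OF continuous_on_frame(2)]
          continuous_on_compose2[OF continuous_on_frame(3)]) auto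
    then show ?thesis
      unfolding f_def by (rule continuous_on_compose2[OF cont]) (use V in auto)
  qed
  define \<Phi> where "\<Phi> p = (f (fst p) (snd p) - f (fst p) (snd p + 1) + f (fst p) (snd p + 2) - f (fst p) (snd p + 3),
     Complex (f (fst p) (snd p) - f (fst p) (snd p + 2)) (f (fst p) (snd p + 1) - f (fst p) (snd p + 3)))" for p
  have "continuous_on (cball 0 1 \<times> UNIV) \<Phi>"
    unfolding \<Phi>_def using cf[of 0] by (intro continuous_intros cf) auto
  moreover have "\<Phi> (z, x + 1) = (- fst (\<Phi> (z, x)), - \<i> * snd (\<Phi> (z, x)))" for z x
    using f4[of z x] by (simp add: \<Phi>_def complex_eq_iff add.assoc)
  moreover have "\<Phi> (- cis (pi * t / 2), 2 * t - x) =
      (fst (\<Phi> (cis (pi * t / 2), x)), cnj (snd (\<Phi> (cis (pi * t / 2), x))))" for t x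
  proof -
    have "f (- cis (pi * t / 2)) (2 * t - x + d) = f (cis (pi * t / 2)) (x + (4 - d))" for d
      using fa[of t "x - d"] f4[of _ "x - d"] by (simp add: algebra_simps)
    from this[of 1] this[of 2] this[of 3] fa[of t x] show ?thesis
      by (simp add: \<Phi>_def complex_eq_iff)
  qed
  ultimately obtain z x where z: "z \<in> cball 0 1" and 0: "\<Phi> (z, x) = 0"
    by (rule twisted_map_has_zero)
  then have eq: "f z (x + 1) = f z x" "f z (x + 2) = f z x" "f z (x + 3) = f z x"
    by (auto simp: \<Phi>_def complex_eq_iff zero_prod_def)
  show ?thesis
    by (rule that[OF on[OF z, of x], of "f z x"])
      (use eq in \<open>auto simp: f_def V_def I2 I3\<close>)
qed

section \<open>Inscribed boxes\<close>

lemma orthogonal_matrix_rows3: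
  assumes "orthonormal3 i j k"
  shows "orthogonal_matrix (vector [i, j, k] :: real^3^3)"
  using assms
  by (simp add: orthonormal3_def orthogonal_matrix_orthonormal_rows forall_3 row_def orthogonal_def inner_commute)

lemma rows3_mult: "(vector [i, j, k] :: real^3^3) *v x = vector [i \<bullet> x, j \<bullet> x, k \<bullet> x]"
  by (simp add: vec_eq_iff forall_3 matrix_vector_mul_component)

lemma orthonormal3_orth_zero:
  assumes "orthonormal3 i j k" "i \<bullet> q = 0" "j \<bullet> q = 0" "k \<bullet> q = 0"
  shows "q = 0"
proof -
  let ?R = "vector [i, j, k] :: real^3^3"
  have "?R *v q = 0" using assms by (simp add: rows3_mult vec_eq_iff forall_3)
  then have "transpose ?R *v (?R *v q) = 0" by simp
  then show ?thesis
    using orthogonal_matrix_rows3[OF assms(1)]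
    by (simp add: matrix_vector_mul_assoc orthogonal_matrix_def)
qed

lemma orthonormal3_transport_matrix:
  assumes "orthonormal3 i j k" "orthonormal3 i' j' k'"
  obtains A :: "real^3^3" where "orthogonal_matrix A" "A *v i = i'" "A *v j = j'" "A *v k = k'"
proof
  let ?R = "vector [i, j, k] :: real^3^3" and ?S = "vector [i', j', k'] :: real^3^3"
  show "orthogonal_matrix (transpose ?S ** ?R)"
    using assms by (intro orthogonal_matrix_mul orthogonal_matrix_rows3) (simp_all add: orthogonal_matrix_rows3)
  have "?R *v i = axis 1 1" "?R *v j = axis 2 1" "?R *v k = axis 3 1"
    using assms(1) by (simp_all add: rows3_mult orthonormal3_def norm_eq_1 inner_commute vec_eq_iff forall_3 axis_def)
  moreover have "column 1 (transpose ?S) = i'" "column 2 (transpose ?S) = j'" "column 3 (transpose ?S) = k'"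
    by (simp_all add: column_transpose row_def vec_eq_iff)
  ultimately show "(transpose ?S ** ?R) *v i = i'" "(transpose ?S ** ?R) *v j = j'" "(transpose ?S ** ?R) *v k = k'"
    by (simp_all add: matrix_vector_mul_assoc[symmetric] matrix_vector_mult_basis)
qed

text \<open>
  In odd dimension \<open>- 1\<close> has determinant \<open>- 1\<close>. As \<open>F\<close> is even, the sign of the matrix does not
  affect its values, and one of \<open>A\<close> and \<open>- A\<close> is a rotation.
\<close>

lemma orthogonal_matrix_pm_rotation:
  fixes A :: "real^3^3"
  assumes "orthogonal_matrix A"
  shows "rotation_matrix A \<or> rotation_matrix (- A)"
proof -
  have "orthogonal_matrix (- A)"
    using assms by (simp add: orthogonal_matrix_orthonormal_rows row_def orthogonal_def norm_vec_def
      L2_set_def inner_vec_def)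
  moreover have "det (- A) = - det A" by (simp add: det_3)
  ultimately show ?thesis
    using det_orthogonal_matrix[OF assms] assms by (auto simp: rotation_matrix_def)
qed

text \<open>
  Two endpoints of an edge have the same norm, so the centre of the box is orthogonal to each edge.
\<close>

lemma inscribed_box_centred:
  assumes box: "box_edges a b c" and V: "box_vertices p a b c \<subseteq> sphere 0 1"
  shows "p = - (1/2) *\<^sub>R (a + b + c)"
proof -
  have o: "a \<bullet> b = 0" "b \<bullet> c = 0" "a \<bullet> c = 0" "a \<noteq> 0" "b \<noteq> 0" "c \<noteq> 0"
    using box by (auto simp: box_edges_def orthogonal_def)
  have "p \<bullet> p = 1" "(p + a) \<bullet> (p + a) = 1" "(p + b) \<bullet> (p + b) = 1" "(p + c) \<bullet> (p + c) = 1"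
    using V by (auto simp: box_vertices_def norm_eq_1)
  then have "a \<bullet> (p + (1/2) *\<^sub>R (a + b + c)) = 0" "b \<bullet> (p + (1/2) *\<^sub>R (a + b + c)) = 0"
    "c \<bullet> (p + (1/2) *\<^sub>R (a + b + c)) = 0"
    using o by (simp_all add: inner_add inner_commute)
  moreover have "orthonormal3 (sgn a) (sgn b) (sgn c)"
    using o by (simp add: orthonormal3_def norm_sgn) (simp add: sgn_div_norm)
  ultimately have "p + (1/2) *\<^sub>R (a + b + c) = 0"
    by (intro orthonormal3_orth_zero[of "sgn a" "sgn b" "sgn c"]) (simp_all add: sgn_div_norm)
  then show ?thesis by (simp add: eq_neg_iff_add_eq_0)
qed

text \<open>
  The diagonals \<open>a + b\<close> and \<open>a - b\<close> of the square face are orthogonal and of equal length; with \<open>c\<close>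
  they provide the frame in which the box has the form treated above.
\<close>

lemma inscribed_box_frame:
  assumes box: "box_edges a b c" and ab: "norm a = norm b"
    and V: "box_vertices p a b c \<subseteq> sphere 0 1"
  obtains i j k :: "real^3" and g s :: real where "orthonormal3 i j k" "g\<^sup>2 + s\<^sup>2 = 1"
    "\<And>x. x \<in> box_vertices p a b c \<Longrightarrow>
       \<exists>y \<in> {g *\<^sub>R k + s *\<^sub>R i, g *\<^sub>R k - s *\<^sub>R i, g *\<^sub>R k + s *\<^sub>R j, g *\<^sub>R k - s *\<^sub>R j}. x = y \<or> x = - y"
proof -
  have o: "a \<bullet> b = 0" "b \<bullet> c = 0" "a \<bullet> c = 0" "a \<noteq> 0" "b \<noteq> 0" "c \<noteq> 0"
    using box by (auto simp: box_edges_def orthogonal_def)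
  have p: "p = - (1/2) *\<^sub>R (a + b + c)" by (rule inscribed_box_centred[OF box V])
  define s where "s = norm a / sqrt 2"
  define g where "g = norm c / 2"
  define i j k where "i = (1 / (2 * s)) *\<^sub>R (a + b)" and "j = (1 / (2 * s)) *\<^sub>R (a - b)"
    and "k = (1 / (2 * g)) *\<^sub>R c"
  have pos: "s \<noteq> 0" "g \<noteq> 0" using o by (simp_all add: s_def g_def)
  have s2: "s\<^sup>2 * 2 = a \<bullet> a" "a \<bullet> a = b \<bullet> b"
    using ab by (simp_all add: s_def power_divide dot_square_norm)
  have ij: "a = s *\<^sub>R i + s *\<^sub>R j" "b = s *\<^sub>R i - s *\<^sub>R j" "c = g *\<^sub>R k + g *\<^sub>R k"
    using pos by (simp_all add: i_def j_def k_def algebra_simps flip: scaleR_left_distrib)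
  have "i \<bullet> i = 1" "j \<bullet> j = 1"
    using o s2 pos by (simp_all add: i_def j_def inner_add inner_diff inner_commute field_simps power2_eq_square)
  moreover have "k \<bullet> k = 1"
    using pos by (simp add: k_def g_def dot_square_norm power2_eq_square)
  moreover have "i \<bullet> j = 0" "j \<bullet> k = 0" "i \<bullet> k = 0"
    using o s2 by (simp_all add: i_def j_def k_def inner_add inner_diff inner_commute)
  ultimately have on: "orthonormal3 i j k" by (simp add: orthonormal3_def norm_eq_1)
  have pe: "p = - s *\<^sub>R i - g *\<^sub>R k"
    unfolding p ij by (simp add: algebra_simps flip: scaleR_left_distrib)
  have "norm p = 1" using V by (simp add: box_vertices_def)
  then have gs: "g\<^sup>2 + s\<^sup>2 = 1"
    unfolding pe using on by (simp add: orthonormal3_def norm_eq_1 inner_diff inner_commute power2_eq_square)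
  have "box_vertices p a b c = {- (g *\<^sub>R k + s *\<^sub>R i), - (g *\<^sub>R k - s *\<^sub>R j), - (g *\<^sub>R k + s *\<^sub>R j),
     g *\<^sub>R k - s *\<^sub>R i, - (g *\<^sub>R k - s *\<^sub>R i), g *\<^sub>R k - s *\<^sub>R j, g *\<^sub>R k + s *\<^sub>R j, g *\<^sub>R k + s *\<^sub>R i}"
    unfolding box_vertices_def pe ij
    by (intro arg_cong2[where f = insert] refl) (simp_all add: algebra_simps)
  then show ?thesis using that[OF on gs] by auto
qed

theorem theorem10:
  fixes F :: "real^3 \<Rightarrow> real" and v :: "nat \<Rightarrow> real^3"
  assumes "continuous_on (sphere 0 1) F"
    and "\<And>x. x \<in> sphere 0 1 \<Longrightarrow> F x = F (- x)"
    and "square_based_box_vertex_set (\<Union>i\<in>{1..4}. {v i, - v i})"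
    and "(\<Union>i\<in>{1..4}. {v i, - v i}) \<subseteq> sphere 0 1"
  shows "\<exists>A :: real^3^3. rotation_matrix A \<and>
           (\<exists>r. \<forall>i\<in>{1..4}. F (A *v v i) = r \<and> F (- (A *v v i)) = r)"
proof -
  let ?V = "\<Union>i\<in>{1..4}. {v i, - v i}"
  obtain p a b c where box: "box_edges a b c" "norm a = norm b" "?V = box_vertices p a b c"
  proof -
    obtain p a b c where *: "box_edges a b c" "square_based a b c" "?V = box_vertices p a b c"
      using assms(3) unfolding square_based_box_vertex_set_def by blast
    have "box_edges b c a" "box_edges a c b"
      using *(1) by (auto simp: box_edges_def orthogonal_commute)
    moreover have "box_vertices p b c a = ?V" "box_vertices p a c b = ?V"
      unfolding *(3) box_vertices_def by (auto simp: add_ac)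
    ultimately show ?thesis using * that unfolding square_based_def by metis
  qed
  obtain i j k :: "real^3" and g s :: real where on: "orthonormal3 i j k" and gs: "g\<^sup>2 + s\<^sup>2 = 1"
    and V: "\<And>x. x \<in> ?V \<Longrightarrow>
       \<exists>y \<in> {g *\<^sub>R k + s *\<^sub>R i, g *\<^sub>R k - s *\<^sub>R i, g *\<^sub>R k + s *\<^sub>R j, g *\<^sub>R k - s *\<^sub>R j}. x = y \<or> x = - y"
    using inscribed_box_frame[OF box(1,2)] assms(4) unfolding box(3) by metis
  obtain i' j' k' r where on': "orthonormal3 i' j' k'"
    and r: "F (g *\<^sub>R k' + s *\<^sub>R i') = r" "F (g *\<^sub>R k' - s *\<^sub>R i') = r"
      "F (g *\<^sub>R k' + s *\<^sub>R j') = r" "F (g *\<^sub>R k' - s *\<^sub>R j') = r"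
    by (rule even_function_balanced_square[OF assms(1,2) gs])
  obtain A where A: "orthogonal_matrix A" "A *v i = i'" "A *v j = j'" "A *v k = k'"
    by (rule orthonormal3_transport_matrix[OF on on'])
  have unit: "norm (A *v x) = 1" if "x \<in> ?V" for x
  proof -
    have "orthogonal_transformation ((*v) A)"
      using A(1) by (simp add: orthogonal_transformation_matrix)
    then show ?thesis using that assms(4) orthogonal_transformation_norm by fastforce
  qed
  have F: "F (A *v x) = r \<and> F (- (A *v x)) = r" if x: "x \<in> ?V" for x
  proof -
    obtain y where y: "y \<in> {g *\<^sub>R k + s *\<^sub>R i, g *\<^sub>R k - s *\<^sub>R i, g *\<^sub>R k + s *\<^sub>R j, g *\<^sub>R k - s *\<^sub>R j}"
      and xy: "x = y \<or> x = - y" using V[OF x] by blast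
    have "F (A *v y) = r"
      using y r by (auto simp: matrix_vector_right_distrib matrix_vector_mult_diff_distrib
          matrix_vector_mult_scaleR A(2-4))
    moreover have "A *v x = A *v y \<or> A *v x = - (A *v y)"
      using xy matrix_vector_mult_diff_distrib[of A 0 y] by auto
    moreover have "F (A *v x) = F (- (A *v x))" by (rule assms(2)) (simp add: unit[OF x])
    ultimately show ?thesis by auto
  qed
  have vV: "v i \<in> ?V" if "i \<in> {1..4}" for i using that by blast
  have neg: "(- A) *v x = - (A *v x)" for x
    by (simp add: matrix_vector_mult_def vec_eq_iff sum_negf)
  from orthogonal_matrix_pm_rotation[OF A(1)] show ?thesis
  proof
    assume "rotation_matrix A"
    then show ?thesis using F[OF vV] by blast
  next
    assume "rotation_matrix (- A)"
    then show ?thesis using F[OF vV] by (intro exI[of _ "- A"]) (auto simp: neg)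
  qed
qed

end
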